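(* Let $d\ge1$, let $S$ be a (possibly infinite) set of connected $d$-dimensional figures, and let $w:S\to\mathbb{Z}^+$ be a function such that for every $x$ there are only finitely many figures $f\in S$ with $w(f)=x$. For $k\ge0$ and $n\ge1$ let $p_k(n^d)$ denote the number of ways to place on $T^d_n$ some finite collection of figures from $S$ (possibly using the same figure of $S$ repeatedly, with copies of the same figure indistinguishable) of total weight $k$, such that no two of the placed figures overlap. Then for each $k$ there are a polynomial $P_k$ and an integer $n_k$ such that $p_k(n^d)=P_k(n^d)$ for all $n\ge n_k$, and the sequence of polynomials $P_0,P_1,P_2,\dots$ is of binomial type.
   Context: $T^d_\infty$ is the infinite grid graph with vertex set $\mathbb{Z}^d$, two vertices being adjacent iff they differ by $\pm$ a standard basis vector. $T^d_n=(C_n)^d$ is the toroidal grid graph with vertex set $(\mathbb{Z}/n\mathbb{Z})^d$. A $d$-dimensional figure is a finite nonempty subset of $\mathbb{Z}^d$, up to translation by integer vectors; it is connected if the subgraph of $T^d_\infty$ it induces is connected. A figure can be placed on $T^d_n$ when $n$ is larger than the maximum coordinate difference between two of its vertices; a placement of it is then the image in $(\mathbb{Z}/n\mathbb{Z})^d$ of a subset of $\mathbb{Z}^d$ representing it. Two placed figures overlap if they share a vertex. The total weight of a collection is the sum, with multiplicity, of the weights $w$ of its figures. A sequence of polynomials $P_0,P_1,P_2,\dots$ is of binomial type if $P_0=1$, $P_i(0)=0$ for $i>0$, and $\left(\sum_{i\ge0}P_i(1)x^i\right)^m=\sum_{i\ge0}P_i(m)x^i$ for all nonnegative integers $m$;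 the third condition may equivalently be replaced by $P_k(x+y)=\sum_{i=0}^kP_i(x)P_{k-i}(y)$ for all $k\ge 0$ (no binomial coefficients in this convention). *)

theory Defs
  imports "HOL-Analysis.Finite_Cartesian_Product" "HOL-Computational_Algebra.Polynomial"
    "HOL-Computational_Algebra.Formal_Power_Series"
begin

text \<open>The dimension is the cardinality of the index type \<open>'d::finite\<close>, so it is automatically
  at least one; vertices of the infinite grid are elements of \<open>int ^ 'd\<close>.\<close>

definition grid_adj :: "int ^ 'd::finite \<Rightarrow> int ^ 'd \<Rightarrow> bool" where
  "grid_adj u v \<longleftrightarrow> (\<exists>i. v = u + axis i 1 \<or> v = u - axis i 1)"

definition connected_in_grid :: "(int ^ 'd::finite) set \<Rightarrow> bool" where
  "connected_in_grid A \<longleftrightarrow>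
     (\<forall>u\<in>A. \<forall>v\<in>A. (u, v) \<in> {(x, y). x \<in> A \<and> y \<in> A \<and> grid_adj x y}\<^sup>*)"

definition shapes :: "(int ^ 'd::finite) set set" where
  "shapes = {A. finite A \<and> A \<noteq> {}}"

definition translation_rel :: "((int ^ 'd::finite) set \<times> (int ^ 'd) set) set" where
  "translation_rel = {(A, B). A \<in> shapes \<and> B \<in> shapes \<and> (\<exists>t. B = (+) t ` A)}"

lemma equiv_translation_rel: "equiv shapes translation_rel"
proof (rule equivI)
  show "translation_rel \<subseteq> shapes \<times> shapes"
    by (auto simp: translation_rel_def)
  show "refl_on shapes translation_rel"
    by (auto simp: refl_on_def translation_rel_def intro!: exI[of _ 0])
  show "sym translation_rel"
  proof (rule symI)
    fix A B :: "(int ^ 'd) set"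
    assume "(A, B) \<in> translation_rel"
    then obtain t where t: "A \<in> shapes" "B \<in> shapes" "B = (+) t ` A"
      by (auto simp: translation_rel_def)
    then have "A = (+) (- t) ` B"
      by (simp add: image_image)
    with t show "(B, A) \<in> translation_rel"
      unfolding translation_rel_def by blast
  qed
  show "trans translation_rel"
  proof (rule transI)
    fix A B C :: "(int ^ 'd) set"
    assume "(A, B) \<in> translation_rel" "(B, C) \<in> translation_rel"
    then obtain s t where st: "A \<in> shapes" "C \<in> shapes" "C = (+) t ` (+) s ` A"
      by (auto simp: translation_rel_def)
    then have "C = (+) (t + s) ` A"
      by (simp add: image_image add.assoc)
    with st show "(A, C) \<in> translation_rel"
      unfolding translation_rel_def by blast
  qed
qed

text \<open>A figure is a whole translation class, that is, a set of subsets of the grid.\<close>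

definition figures :: "(int ^ 'd::finite) set set set" where
  "figures = shapes // translation_rel"

definition connected_figure :: "(int ^ 'd::finite) set set \<Rightarrow> bool" where
  "connected_figure F \<longleftrightarrow> (\<forall>A\<in>F. connected_in_grid A)"

text \<open>Vertices of the torus are represented by their reduced residues, that is, by the vectors
  all of whose coordinates lie in \<open>{0..<n}\<close>.\<close>

definition torus_proj :: "nat \<Rightarrow> int ^ 'd::finite \<Rightarrow> int ^ 'd" where
  "torus_proj n v = (\<chi> i. v $ i mod int n)"

definition fits_torus :: "nat \<Rightarrow> (int ^ 'd::finite) set \<Rightarrow> bool" where
  "fits_torus n A \<longleftrightarrow> (\<forall>u\<in>A. \<forall>v\<in>A. \<forall>i. \<bar>u $ i - v $ i\<bar> < int n)"

definition placements :: "nat \<Rightarrow> (int ^ 'd::finite) set set \<Rightarrow> (int ^ 'd) set set" where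
  "placements n F = {torus_proj n ` A | A. A \<in> F \<and> fits_torus n A}"

text \<open>A placed figure is recorded as the pair of the figure and its placement, since different
  figures may have the same image on a small torus. A finite collection of placed figures is a
  finite set of such pairs. A set suffices even though a figure may be used repeatedly: figures are
  nonempty, so copies of one figure that do not overlap have different placements. Each copy is
  then a separate element, and the total weight counts it separately.\<close>

definition packings ::
  "(int ^ 'd::finite) set set set \<Rightarrow> ((int ^ 'd) set set \<Rightarrow> nat) \<Rightarrow> nat \<Rightarrow> nat \<Rightarrow>
   ((int ^ 'd) set set \<times> (int ^ 'd) set) set set" where
  "packings S w k n =
     {C. finite C \<and> (\<forall>(F, X)\<in>C. F \<in> S \<and> X \<in> placements n F) \<and>
         (\<forall>a\<in>C. \<forall>b\<in>C. a \<noteq> b \<longrightarrow> snd a \<inter> snd b = {}) \<and>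
         (\<Sum>(F, X)\<in>C. w F) = k}"

definition num_packings ::
  "(int ^ 'd::finite) set set set \<Rightarrow> ((int ^ 'd) set set \<Rightarrow> nat) \<Rightarrow> nat \<Rightarrow> nat \<Rightarrow> nat" where
  "num_packings S w k n = card (packings S w k n)"

text \<open>The convention here is the one without binomial coefficients.\<close>

definition binomial_type :: "(nat \<Rightarrow> real poly) \<Rightarrow> bool" where
  "binomial_type P \<longleftrightarrow>
     P 0 = 1 \<and> (\<forall>i>0. poly (P i) 0 = 0) \<and>
     (\<forall>m::nat. Abs_fps (\<lambda>i. poly (P i) 1) ^ m = Abs_fps (\<lambda>i. poly (P i) (of_nat m)))"

end

theory Submission imports Defs begin

text \<open>Let \<open>Z\<^sub>n(B)\<close> be the generating function, by total weight, of the packings of the torus that avoid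
  a vertex set \<open>B\<close>, and let \<open>Z\<^sub>n\<close> be \<open>Z\<^sub>n(\<emptyset>)\<close>. The claim amounts to \<open>Z\<^sub>n = exp(N c(x))\<close> with
  \<open>N = n\<^sup>d\<close> and a power series \<open>c\<close> each of whose coefficients stops depending on \<open>n\<close>. It is easier
  to control the logarithmic derivative of \<open>Z\<^sub>n\<close> than its logarithm.

  Marking one placed figure \<open>X\<close> of a packing, with multiplicity its weight, and then deleting it
  leaves a packing that avoids \<open>X\<close>. As all the placements of a figure \<open>F\<close> are translates of each
  other and there are \<open>N\<close> of them once \<open>n\<close> is large, this gives
  \<open>x Z\<^sub>n' = N Z\<^sub>n D\<^sub>n\<close>, where \<open>D\<^sub>n\<close> is the sum over the figures \<open>F\<close> of
  \<open>w(F) x\<^bsup>w(F)\<^esup> Z\<^sub>n(A\<^sub>F) / Z\<^sub>n\<close> with one fixed placement \<open>A\<^sub>F\<close> for each \<open>F\<close>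
  (\<open>eventually_num_packings_recurrence\<close>).

  The point is that the ratios \<open>Z\<^sub>n(B) / Z\<^sub>n\<close> are local: for a fixed finite set \<open>B\<close> in the infinite
  grid, each of their coefficients is constant for large \<open>n\<close> (\<open>ratio_eventually_constant\<close>).
  Indeed a packing that avoids \<open>B\<close> either avoids a further vertex \<open>v\<close> too, or has exactly one placed
  figure \<open>X\<close> through \<open>v\<close>, so that \<open>Z\<^sub>n(B \<union> {v}) = Z\<^sub>n(B) - (\<Sum>X. x\<^bsup>w(X)\<^esup> Z\<^sub>n(B \<union> X))\<close>. After
  division by \<open>Z\<^sub>n\<close> this expresses the coefficients for \<open>B \<union> {v}\<close> by coefficients for \<open>B\<close> and by
  coefficients of lower degree, and the placed figures through \<open>v\<close> that occur in it are the same
  on every large torus as in the infinite grid.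

  Hence the coefficients of \<open>D\<^sub>n\<close> stabilise to numbers \<open>d\<^sub>i\<close> with \<open>d\<^sub>0 = 0\<close>, and comparing coefficients
  in \<open>x H' = t D H\<close> defines polynomials \<open>P\<^sub>k(t)\<close> that agree with the numbers of packings at
  \<open>t = N\<close>. For a natural number \<open>m\<close>, the power \<open>H\<^sub>1\<^sup>m\<close> solves the equation with \<open>t = m\<close> and constant
  term 1, so uniqueness of its solution makes the sequence of binomial type
  (\<open>binomial_type_log_deriv_poly\<close>).\<close>

unbundle fps_syntax
unbundle no vec_syntax

section \<open>Generating functions of hard-core configurations\<close>

text \<open>The two identities behind the proof are not special to the grid. They hold for any set of
  weighted objects, each occupying a nonempty set of sites, in which configurations are families
  of objects with disjoint sites. The set \<open>Q\<close> of objects may be infinite, which is why the identities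
  are stated coefficient by coefficient with the weights truncated.\<close>

locale hard_core_gas =
  fixes Q :: "'p set" and wt :: "'p \<Rightarrow> nat" and locus :: "'p \<Rightarrow> 'v set"
  assumes wt_pos: "p \<in> Q \<Longrightarrow> wt p > 0"
    and finite_wt_eq: "finite {p \<in> Q. wt p = k}"
    and locus_nonempty: "p \<in> Q \<Longrightarrow> locus p \<noteq> {}"
begin

definition configs :: "'v set \<Rightarrow> nat \<Rightarrow> 'p set set" where
  "configs B k = {C. finite C \<and> C \<subseteq> Q \<and> (\<forall>a\<in>C. locus a \<inter> B = {}) \<and>
     (\<forall>a\<in>C. \<forall>b\<in>C. a \<noteq> b \<longrightarrow> locus a \<inter> locus b = {}) \<and> sum wt C = k}"

definition Z :: "'v set \<Rightarrow> real fps" where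
  "Z B = Abs_fps (\<lambda>k. real (card (configs B k)))"

definition ratio :: "'v set \<Rightarrow> real fps" where
  "ratio B = Z B * inverse (Z {})"

lemma finite_wt_le: "finite {p \<in> Q. wt p \<le> k}"
proof -
  have "{p \<in> Q. wt p \<le> k} = (\<Union>i\<in>{..k}. {p \<in> Q. wt p = i})" by auto
  then show ?thesis using finite_wt_eq by simp
qed

lemma finite_configs: "finite (configs B k)"
proof (rule finite_subset)
  show "configs B k \<subseteq> Pow {p \<in> Q. wt p \<le> k}"
    by (auto simp: configs_def intro: member_le_sum)
qed (simp add: finite_wt_le)

lemma configs_disjoint:
  "C \<in> configs B k \<Longrightarrow> a \<in> C \<Longrightarrow> b \<in> C \<Longrightarrow> a \<noteq> b \<Longrightarrow> locus a \<inter> locus b = {}"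
  by (simp add: configs_def)

lemma configs_0: "configs B 0 = {{}}"
proof -
  have "C = {}" if "C \<in> configs B 0" for C
  proof (rule ccontr)
    assume "C \<noteq> {}"
    then obtain p where p: "p \<in> C" by blast
    have C: "finite C" "C \<subseteq> Q" "sum wt C = 0" using that by (simp_all add: configs_def)
    have "wt p = 0" using C p by simp
    moreover have "p \<in> Q" using C p by blast
    ultimately show False using wt_pos[of p] by simp
  qed
  moreover have "{} \<in> configs B 0" by (simp add: configs_def)
  ultimately show ?thesis by blast
qed

lemma Z_nth_0 [simp]: "Z B $ 0 = 1"
  by (simp add: Z_def configs_0)

lemma ratio_empty: "ratio {} = 1"
  by (simp add: ratio_def inverse_mult_eq_1')

lemma ratio_times_Z: "ratio B * Z {} = Z B"
  by (simp add: ratio_def mult.assoc inverse_mult_eq_1)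

lemma config_remove:
  assumes C: "C \<in> configs B k" and p: "p \<in> C"
  shows "p \<in> Q" "locus p \<inter> B = {}" "wt p \<le> k" "C - {p} \<in> configs (B \<union> locus p) (k - wt p)"
proof -
  have C': "finite C" "C \<subseteq> Q" "sum wt C = k" "\<forall>a\<in>C. locus a \<inter> B = {}"
    using C by (simp_all add: configs_def)
  have s: "k = wt p + sum wt (C - {p})"
    using sum.remove[OF C'(1) p, of wt] C'(3) by simp
  show "p \<in> Q" "locus p \<inter> B = {}" "wt p \<le> k" using C' p s by auto
  have "locus a \<inter> (B \<union> locus p) = {}" if "a \<in> C - {p}" for a
    using that C'(4) configs_disjoint[OF C _ p, of a] by auto
  moreover have "C - {p} \<subseteq> Q" using C'(2) by auto
  ultimately show "C - {p} \<in> configs (B \<union> locus p) (k - wt p)"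
    using C'(1) s configs_disjoint[OF C] by (simp add: configs_def)
qed

lemma config_insert:
  assumes p: "p \<in> Q" "locus p \<inter> B = {}" "wt p \<le> k"
    and C: "C \<in> configs (B \<union> locus p) (k - wt p)"
  shows "p \<notin> C" "insert p C \<in> configs B k"
proof -
  have C': "finite C" "C \<subseteq> Q" "sum wt C = k - wt p"
    and avoid: "\<And>a. a \<in> C \<Longrightarrow> locus a \<inter> (B \<union> locus p) = {}"
    using C by (simp_all add: configs_def)
  show np: "p \<notin> C" using avoid[of p] locus_nonempty[OF p(1)] by auto
  have "sum wt (insert p C) = k" using np C' p(3) by simp
  moreover have "locus a \<inter> B = {}" if "a \<in> insert p C" for a
    using that avoid p(2) by blast
  moreover have "locus a \<inter> locus b = {}" if "a \<in> insert p C" "b \<in> insert p C" "a \<noteq> b" for a b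
    using that configs_disjoint[OF C, of a b] avoid[of a] avoid[of b] by blast
  moreover have "finite (insert p C)" "insert p C \<subseteq> Q" using C' p(1) by auto
  ultimately show "insert p C \<in> configs B k" unfolding configs_def by blast
qed

text \<open>Deleting the marked object \<open>p\<close> gives a configuration that avoids \<open>locus p\<close> as well. The map has an
  inverse because loci are nonempty: no object of the remaining configuration can equal \<open>p\<close>.\<close>

lemma sum_over_marked_configs:
  fixes f :: "'p \<Rightarrow> real"
  shows "(\<Sum>C\<in>configs B k. \<Sum>p\<in>{p\<in>C. R p}. f p) =
    (\<Sum>p | p \<in> Q \<and> R p \<and> locus p \<inter> B = {} \<and> wt p \<le> k. f p * Z (B \<union> locus p) $ (k - wt p))"
    (is "_ = (\<Sum>p\<in>?T. _)")
proof -
  have finT: "finite ?T"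
    by (rule finite_subset[OF _ finite_wt_le[of k]]) auto
  have "(\<Sum>C\<in>configs B k. \<Sum>p\<in>{p\<in>C. R p}. f p)
      = (\<Sum>(C,p)\<in>(SIGMA C:configs B k. {p\<in>C. R p}). f p)"
    by (rule sum.Sigma) (auto simp: finite_configs, auto simp: configs_def)
  also have "\<dots> = (\<Sum>(p,C)\<in>(SIGMA p:?T. configs (B \<union> locus p) (k - wt p)). f p)"
  proof (rule sum.reindex_bij_witness[where
        i = "\<lambda>(p,C). (insert p C, p)" and j = "\<lambda>(C,p). (p, C - {p})"]; clarsimp)
    fix C p assume C: "C \<in> configs B k" and p: "p \<in> C" "R p"
    show "insert p C = C" using p by auto
    show "p \<in> Q \<and> locus p \<inter> B = {} \<and> wt p \<le> k \<and> C - {p} \<in> configs (B \<union> locus p) (k - wt p)"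
      using config_remove[OF C p(1)] by simp
  next
    fix C p
    assume p: "p \<in> Q" "R p" "locus p \<inter> B = {}" "wt p \<le> k"
      and C: "C \<in> configs (B \<union> locus p) (k - wt p)"
    show "C - {p} = C" using config_insert(1)[OF p(1,3,4) C] by auto
    show "insert p C \<in> configs B k" by (rule config_insert(2)[OF p(1,3,4) C])
  qed
  also have "\<dots> = (\<Sum>p\<in>?T. \<Sum>C\<in>configs (B \<union> locus p) (k - wt p). f p)"
    by (rule sum.Sigma[symmetric]) (auto simp: finT finite_configs)
  also have "\<dots> = (\<Sum>p\<in>?T. f p * Z (B \<union> locus p) $ (k - wt p))"
    by (simp add: Z_def mult.commute)
  finally show ?thesis .
qed

text \<open>Stated as an inequality so that only injectivity is asked for; applied to a symmetry and to its
  inverse it gives the invariance of the counts.\<close>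

lemma card_configs_image_le:
  assumes "inj_on \<sigma> Q" "\<sigma> ` Q \<subseteq> Q"
    and wt: "\<And>p. p \<in> Q \<Longrightarrow> wt (\<sigma> p) = wt p"
    and locus: "\<And>p. p \<in> Q \<Longrightarrow> locus (\<sigma> p) = g ` locus p"
    and V: "\<And>p. p \<in> Q \<Longrightarrow> locus p \<subseteq> V" "B \<subseteq> V" and g: "inj_on g V"
  shows "card (configs B k) \<le> card (configs (g ` B) k)"
proof (rule card_inj_on_le[OF _ _ finite_configs])
  show "inj_on ((`) \<sigma>) (configs B k)"
    by (rule inj_on_subset[OF inj_on_image_Pow[OF assms(1)]]) (auto simp: configs_def)
  show "(`) \<sigma> ` configs B k \<subseteq> configs (g ` B) k"
  proof clarify
    fix C assume C: "C \<in> configs B k"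
    then have CQ: "C \<subseteq> Q" and fin: "finite C" by (auto simp: configs_def)
    have "sum wt (\<sigma> ` C) = sum wt C"
      using inj_on_subset[OF assms(1) CQ] wt CQ by (auto simp: sum.reindex intro!: sum.cong)
    moreover have "locus (\<sigma> a) \<inter> g ` B = {}" if "a \<in> C" for a
    proof -
      have a: "a \<in> Q" using that CQ by auto
      have "locus a \<inter> B = {}" using that C by (simp add: configs_def)
      then show ?thesis
        using inj_on_image_Int[OF g V(1)[OF a] V(2)] a by (simp add: locus)
    qed
    moreover have "locus (\<sigma> a) \<inter> locus (\<sigma> b) = {}" if "a \<in> C" "b \<in> C" "\<sigma> a \<noteq> \<sigma> b" for a b
    proof -
      have ab: "a \<in> Q" "b \<in> Q" using that CQ by auto
      have "a \<noteq> b" using that(3) by auto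
      then have "locus a \<inter> locus b = {}" by (rule configs_disjoint[OF C that(1,2)])
      then show ?thesis
        using inj_on_image_Int[OF g V(1)[OF ab(1)] V(1)[OF ab(2)]] ab by (simp add: locus)
    qed
    moreover have "\<sigma> ` C \<subseteq> Q" using CQ assms(2) by blast
    ultimately show "\<sigma> ` C \<in> configs (g ` B) k"
      using C by (simp add: configs_def)
  qed
qed

text \<open>Mark the object whose locus contains \<open>v\<close>. A configuration has at most one of them, and it has none
  iff it avoids \<open>v\<close>.\<close>

lemma Z_insert:
  "Z B $ k = Z (insert v B) $ k +
    (\<Sum>p | p \<in> Q \<and> v \<in> locus p \<and> locus p \<inter> B = {} \<and> wt p \<le> k. Z (B \<union> locus p) $ (k - wt p))"
proof -
  have split: "(\<Sum>p\<in>{p\<in>C. v \<in> locus p}. 1::real) = (if C \<in> configs (insert v B) k then 0 else 1)"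
    if C: "C \<in> configs B k" for C
  proof (cases "C \<in> configs (insert v B) k")
    case True
    then have none: "{p\<in>C. v \<in> locus p} = {}" by (auto simp: configs_def)
    show ?thesis unfolding none using True by simp
  next
    case False
    then obtain p where p: "p \<in> C" "v \<in> locus p" using C unfolding configs_def by blast
    then have one: "{p\<in>C. v \<in> locus p} = {p}" using configs_disjoint[OF C] by blast
    show ?thesis unfolding one using False by simp
  qed
  have sub: "configs (insert v B) k \<subseteq> configs B k" by (auto simp: configs_def)
  have "(\<Sum>p | p \<in> Q \<and> v \<in> locus p \<and> locus p \<inter> B = {} \<and> wt p \<le> k. Z (B \<union> locus p) $ (k - wt p))
     = (\<Sum>C\<in>configs B k. \<Sum>p\<in>{p\<in>C. v \<in> locus p}. 1)"
    by (subst sum_over_marked_configs) simp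
  also have "\<dots> = (\<Sum>C\<in>configs B k. if C \<in> configs (insert v B) k then 0 else 1)"
    by (rule sum.cong) (simp_all only: split)
  also have "\<dots> = real (card (configs B k - configs (insert v B) k))"
    by (simp add: sum.If_cases finite_configs set_diff_eq Collect_conj_eq[symmetric] Int_def)
  also have "\<dots> = Z B $ k - Z (insert v B) $ k"
    using sub finite_configs card_mono[OF finite_configs sub]
    by (simp add: card_Diff_subset Z_def of_nat_diff)
  finally show ?thesis by simp
qed

text \<open>Each coefficient on the right belongs either to the smaller set \<open>B\<close> or to a degree below \<open>j\<close>, since
  weights are positive. This makes it a recursion for all the ratios.\<close>

lemma ratio_insert:
  "ratio (insert v B) $ j = ratio B $ j -
    (\<Sum>p | p \<in> Q \<and> v \<in> locus p \<and> locus p \<inter> B = {} \<and> wt p \<le> j.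
        ratio (B \<union> locus p) $ (j - wt p))"
proof -
  define T where "T = {p \<in> Q. v \<in> locus p \<and> locus p \<inter> B = {} \<and> wt p \<le> j}"
  \<comment> \<open>The full sum over objects through \<open>v\<close> may be infinite; up to degree \<open>j\<close> it agrees with \<open>G\<close>.\<close>
  define G where "G = (\<Sum>p\<in>T. fps_X ^ wt p * Z (B \<union> locus p))"
  have finT: "finite T"
    unfolding T_def by (rule finite_subset[OF _ finite_wt_le[of j]]) auto
  have low: "Z (insert v B) $ a = (Z B - G) $ a" if "a \<le> j" for a
  proof -
    have "G $ a = (\<Sum>p\<in>T. if wt p \<le> a then Z (B \<union> locus p) $ (a - wt p) else 0)"
      unfolding G_def by (auto simp: fps_sum_nth fps_X_power_mult_nth intro!: sum.cong)
    also have "\<dots> = (\<Sum>p\<in>T \<inter> {p. wt p \<le> a}. Z (B \<union> locus p) $ (a - wt p))"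
      by (simp add: sum.If_cases finT)
    also have "T \<inter> {p. wt p \<le> a} = {p \<in> Q. v \<in> locus p \<and> locus p \<inter> B = {} \<and> wt p \<le> a}"
      using that by (auto simp: T_def)
    finally show ?thesis using Z_insert[of B a v] by simp
  qed
  have "ratio (insert v B) $ j = ((Z B - G) * inverse (Z {})) $ j"
    unfolding ratio_def fps_mult_nth by (rule sum.cong) (auto simp: low)
  also have "\<dots> = ratio B $ j - (\<Sum>p\<in>T. (fps_X ^ wt p * ratio (B \<union> locus p)) $ j)"
    by (simp add: G_def ratio_def algebra_simps sum_distrib_right sum_distrib_left fps_sum_nth)
  also have "(\<Sum>p\<in>T. (fps_X ^ wt p * ratio (B \<union> locus p)) $ j)
      = (\<Sum>p\<in>T. ratio (B \<union> locus p) $ (j - wt p))"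
    by (rule sum.cong) (auto simp: fps_X_power_mult_nth T_def)
  finally show ?thesis by (simp add: T_def)
qed

text \<open>This is the coefficient form of \<open>x Z' = (\<Sum>p. wt p x\<^bsup>wt p\<^esup> Z(locus p))\<close>: the total weight of a
  configuration is the number of its marked objects, counted with weight.\<close>

lemma weighted_Z_nth:
  "real k * Z {} $ k = (\<Sum>p | p \<in> Q \<and> wt p \<le> k. real (wt p) * Z (locus p) $ (k - wt p))"
proof -
  have "real k * Z {} $ k = (\<Sum>C\<in>configs {} k. real k)" by (simp add: Z_def)
  also have "\<dots> = (\<Sum>C\<in>configs {} k. \<Sum>p\<in>{p\<in>C. True}. real (wt p))"
    by (rule sum.cong) (auto simp: configs_def simp flip: of_nat_sum)
  also have "\<dots> = (\<Sum>p | p \<in> Q \<and> wt p \<le> k. real (wt p) * Z (locus p) $ (k - wt p))"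
    by (subst sum_over_marked_configs) simp
  finally show ?thesis .
qed

end

section \<open>Polynomials of binomial type from a logarithmic derivative\<close>

text \<open>The coefficients of the power series solution \<open>H\<close> of \<open>x H' = t D H\<close> with constant term 1, as
  polynomials in \<open>t\<close>, where \<open>D\<close> is the series \<open>d\<^sub>1 x + d\<^sub>2 x\<^sup>2 + \<dots>\<close>. In other words,
  \<open>H = exp(t (d\<^sub>1 x + d\<^sub>2 x\<^sup>2 / 2 + d\<^sub>3 x\<^sup>3 / 3 + \<dots>))\<close>.\<close>

fun log_deriv_poly :: "(nat \<Rightarrow> real) \<Rightarrow> nat \<Rightarrow> real poly" where
  "log_deriv_poly d 0 = 1"
| "log_deriv_poly d (Suc k) =
     smult (1 / real (Suc k)) ([:0, 1:] * (\<Sum>i\<le>k. smult (d (Suc i)) (log_deriv_poly d (k - i))))"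

lemma log_deriv_poly_rec:
  "real (Suc k) * poly (log_deriv_poly d (Suc k)) t =
     t * (\<Sum>i\<le>k. d (Suc i) * poly (log_deriv_poly d (k - i)) t)"
  by (simp add: poly_sum field_simps del: of_nat_Suc)

text \<open>The recurrence is assumed only below \<open>k\<close> because, for a given torus, the packing numbers satisfy it
  only in low degrees.\<close>

lemma log_deriv_poly_unique:
  fixes a :: "nat \<Rightarrow> real"
  assumes "a 0 = 1"
    and "\<And>j. j < k \<Longrightarrow> real (Suc j) * a (Suc j) = t * (\<Sum>i\<le>j. d (Suc i) * a (j - i))"
  shows "a k = poly (log_deriv_poly d k) t"
  using assms(2)
proof (induction k rule: less_induct)
  case (less k)
  show ?case
  proof (cases k)
    case 0
    then show ?thesis using assms(1) by simp
  next
    case (Suc j)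
    have IH: "a (j - i) = poly (log_deriv_poly d (j - i)) t" for i
      by (rule less.IH, simp add: Suc, rule less.prems, simp add: Suc)
    have "real (Suc j) * a (Suc j) = t * (\<Sum>i\<le>j. d (Suc i) * a (j - i))"
      by (rule less.prems) (simp add: Suc)
    also have "\<dots> = t * (\<Sum>i\<le>j. d (Suc i) * poly (log_deriv_poly d (j - i)) t)"
      by (simp only: IH)
    also have "\<dots> = real (Suc j) * poly (log_deriv_poly d (Suc j)) t"
      by (simp only: log_deriv_poly_rec)
    finally show ?thesis
      unfolding Suc mult_cancel_left by (simp del: log_deriv_poly.simps)
  qed
qed

text \<open>The equation \<open>H' = t D H\<close> (with \<open>D\<close> now divided by \<open>x\<close>) turns powers of the solution into
  multiples of \<open>t\<close>: both \<open>H\<^sub>1\<^sup>m\<close> and \<open>H\<^sub>m\<close> solve it for \<open>t = m\<close>.\<close>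

lemma binomial_type_log_deriv_poly: "binomial_type (log_deriv_poly d)"
proof -
  define H where "H = (\<lambda>t. Abs_fps (\<lambda>i. poly (log_deriv_poly d i) t))"
  define D where "D = Abs_fps (\<lambda>i. d (Suc i))"
  have H1: "fps_deriv (H 1) = D * H 1"
  proof (rule fps_ext)
    fix k show "fps_deriv (H 1) $ k = (D * H 1) $ k"
      using log_deriv_poly_rec[of k d 1]
      by (simp add: H_def D_def fps_mult_nth atLeast0AtMost del: log_deriv_poly.simps)
  qed
  have pow: "fps_deriv (H 1 ^ m) = fps_const (real m) * D * H 1 ^ m" for m
  proof (cases m)
    case (Suc l)
    have "fps_deriv (H 1 ^ m) = fps_const (real m) * (D * H 1) * H 1 ^ (m - 1)"
      by (simp add: fps_deriv_power H1 mult.assoc)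
    then show ?thesis by (simp add: Suc mult.assoc)
  qed simp
  have "(H 1 ^ m) $ k = poly (log_deriv_poly d k) (real m)" for m k
  proof (rule log_deriv_poly_unique)
    show "(H 1 ^ m) $ 0 = 1" by (simp add: H_def fps_power_zeroth)
    fix j
    have "real (Suc j) * (H 1 ^ m) $ Suc j = fps_deriv (H 1 ^ m) $ j" by simp
    also have "\<dots> = real m * (D * H 1 ^ m) $ j" by (simp add: pow mult.assoc)
    also have "(D * H 1 ^ m) $ j = (\<Sum>i\<le>j. d (Suc i) * (H 1 ^ m) $ (j - i))"
      by (simp add: fps_mult_nth D_def atLeast0AtMost)
    finally show "real (Suc j) * (H 1 ^ m) $ Suc j
        = real m * (\<Sum>i\<le>j. d (Suc i) * (H 1 ^ m) $ (j - i))" .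
  qed
  then have "H 1 ^ m = H (real m)" for m
    by (intro fps_ext) (simp add: H_def)
  moreover have "poly (log_deriv_poly d i) 0 = 0" if "i > 0" for i
    using that by (cases i) auto
  ultimately show ?thesis by (simp add: binomial_type_def H_def)
qed

unbundle no fps_syntax
unbundle vec_syntax

section \<open>Figures on the torus\<close>

definition torus_translate :: "nat \<Rightarrow> int ^ 'd::finite \<Rightarrow> (int ^ 'd) set \<Rightarrow> (int ^ 'd) set" where
  "torus_translate n t X = (\<lambda>v. torus_proj n (t + v)) ` X"

text \<open>All coordinate differences are below \<open>n/2\<close>, not just below \<open>n\<close> as in \<open>fits_torus\<close>. The factor 2 is
  what makes different translations give different placements: the two-point set with difference
  \<open>n/2\<close> on the circle of length \<open>n\<close> is mapped to itself by half a turn.\<close>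

definition roomy :: "nat \<Rightarrow> (int ^ 'd::finite) set \<Rightarrow> bool" where
  "roomy n A \<longleftrightarrow> (\<forall>u\<in>A. \<forall>v\<in>A. \<forall>i. 2 * \<bar>u $ i - v $ i\<bar> < int n)"

lemma torus_proj_nth [simp]: "torus_proj n v $ i = v $ i mod int n"
  by (simp add: torus_proj_def)

lemma torus_proj_add: "torus_proj n (t + torus_proj n v) = torus_proj n (t + v)"
  by (simp add: vec_eq_iff mod_simps)

lemma torus_proj_diff: "torus_proj n (torus_proj n u - t) = torus_proj n (u - t)"
  by (simp add: vec_eq_iff mod_simps)

lemma torus_proj_idem [simp]: "torus_proj n (torus_proj n v) = torus_proj n v"
  by (simp add: vec_eq_iff)

lemma torus_translate_proj: "torus_translate n t (torus_proj n ` A) = torus_proj n ` (+) t ` A"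
  by (simp add: torus_translate_def image_image torus_proj_add)

lemma inj_on_torus_translate:
  fixes t :: "int ^ 'd::finite"
  shows "inj_on (\<lambda>v. torus_proj n (t + v)) (range (torus_proj n))"
proof (rule inj_on_inverseI[where g = "\<lambda>v. torus_proj n (- t + v)"])
  fix v :: "int ^ 'd" assume "v \<in> range (torus_proj n)"
  then show "torus_proj n (- t + torus_proj n (t + v)) = v"
    by (auto simp: torus_proj_add torus_proj_diff)
qed

lemma torus_translate_inverse:
  assumes "X \<subseteq> range (torus_proj n)"
  shows "torus_translate n (- t) (torus_translate n t X) = X"
proof -
  have "torus_translate n (- t) (torus_translate n t X) = torus_proj n ` X"
    by (simp add: torus_translate_def image_image torus_proj_add torus_proj_diff)
  also have "\<dots> = id ` X"
    using assms by (intro image_cong) auto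
  finally show ?thesis by simp
qed

lemma finite_range_torus_proj:
  assumes "n > 0" shows "finite (range (torus_proj n :: int ^ 'd::finite \<Rightarrow> _))"
    and "card (range (torus_proj n :: int ^ 'd \<Rightarrow> _)) = n ^ CARD('d)"
proof -
  have "range (torus_proj n :: int ^ 'd \<Rightarrow> _) = vec_lambda ` (UNIV \<rightarrow>\<^sub>E {0..<int n})" (is "?L = ?R")
  proof
    show "?L \<subseteq> ?R"
    proof clarify
      fix v :: "int ^ 'd"
      have "(\<lambda>i. v $ i mod int n) \<in> UNIV \<rightarrow>\<^sub>E {0..<int n}" using assms by auto
      then show "torus_proj n v \<in> ?R" unfolding torus_proj_def by blast
    qed
    show "?R \<subseteq> ?L"
    proof clarify
      fix f :: "'d \<Rightarrow> int" assume f: "f \<in> UNIV \<rightarrow>\<^sub>E {0..<int n}"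
      have "0 \<le> f i \<and> f i < int n" for i using f by auto
      then have "vec_lambda f = torus_proj n (vec_lambda f)"
        by (simp add: vec_eq_iff)
      then show "vec_lambda f \<in> ?L" by (rule range_eqI)
    qed
  qed
  moreover have "inj_on vec_lambda (UNIV \<rightarrow>\<^sub>E {0..<int n} :: ('d \<Rightarrow> int) set)"
    by (auto intro!: inj_onI simp: vec_lambda_inject)
  ultimately show "finite (range (torus_proj n :: int ^ 'd \<Rightarrow> _))"
    and "card (range (torus_proj n :: int ^ 'd \<Rightarrow> _)) = n ^ CARD('d)"
    by (simp_all add: finite_PiE card_image card_PiE)
qed

lemma eventually_roomy: "finite A \<Longrightarrow> eventually (\<lambda>n. roomy n A) sequentially"
proof -
  assume A: "finite A"
  have "eventually (\<lambda>n. 2 * \<bar>u $ i - v $ i\<bar> < int n) sequentially" for u v :: "int ^ 'd::finite" and i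
    by (rule eventually_sequentiallyI[of "nat (2 * \<bar>u $ i - v $ i\<bar> + 1)"]) auto
  then show ?thesis
    unfolding roomy_def using A by (intro eventually_ball_finite eventually_all_finite ballI) auto
qed

lemma roomy_subset: "roomy n A \<Longrightarrow> B \<subseteq> A \<Longrightarrow> roomy n B"
  by (auto simp: roomy_def)

lemma roomy_fits:
  assumes "roomy n A" shows "fits_torus n A"
  unfolding fits_torus_def
proof (intro ballI allI)
  fix u v i assume "u \<in> A" "v \<in> A"
  then have "2 * \<bar>u $ i - v $ i\<bar> < int n" using assms by (simp add: roomy_def)
  moreover have "\<bar>u $ i - v $ i\<bar> \<le> 2 * \<bar>u $ i - v $ i\<bar>" by simp
  ultimately show "\<bar>u $ i - v $ i\<bar> < int n" by (rule le_less_trans[rotated])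
qed

lemma inj_on_torus_proj:
  assumes "roomy n A" shows "inj_on (torus_proj n) A"
proof (rule inj_onI)
  fix u v assume uv: "u \<in> A" "v \<in> A" "torus_proj n u = torus_proj n v"
  have "u $ i = v $ i" for i
  proof -
    have "u $ i mod int n = v $ i mod int n" using uv(3) by (metis torus_proj_nth)
    then have "int n dvd u $ i - v $ i" by (simp add: mod_eq_dvd_iff)
    moreover have "\<bar>u $ i - v $ i\<bar> < int n"
      using roomy_fits[OF assms] uv(1,2) by (simp add: fits_torus_def)
    ultimately show ?thesis using dvd_imp_le_int[of "u $ i - v $ i" "int n"] by force
  qed
  then show "u = v" by (simp add: vec_eq_iff)
qed

lemma fits_torus_translate [simp]: "fits_torus n ((+) t ` A) \<longleftrightarrow> fits_torus n A"
  by (simp add: fits_torus_def)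

lemma figure_rep:
  assumes "F \<in> figures" "A \<in> F"
  shows "F = range (\<lambda>t. (+) t ` A)" "finite A" "A \<noteq> {}"
proof -
  obtain A0 where A0: "A0 \<in> shapes" "F = translation_rel `` {A0}"
    using assms(1) by (auto simp: figures_def quotient_def)
  then have AA: "(A0, A) \<in> translation_rel" using assms by simp
  have F: "F = translation_rel `` {A}"
    using equiv_class_eq[OF equiv_translation_rel AA] A0 by simp
  have A: "A \<in> shapes" using AA by (simp add: translation_rel_def)
  then show "finite A" "A \<noteq> {}" by (auto simp: shapes_def)
  have "(+) t ` A \<in> shapes" for t using A by (simp add: shapes_def)
  then show "F = range (\<lambda>t. (+) t ` A)" using A unfolding F translation_rel_def by auto
qed

lemma figure_nonempty: "F \<in> figures \<Longrightarrow> \<exists>A. A \<in> F"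
  using in_quotient_imp_non_empty[OF equiv_translation_rel] unfolding figures_def by blast

lemma figure_translate: "F \<in> figures \<Longrightarrow> A \<in> F \<Longrightarrow> (+) t ` A \<in> F"
  using figure_rep(1) by blast

lemma finite_figure_through:
  assumes "F \<in> figures" shows "finite {A \<in> F. v \<in> A}"
proof -
  obtain A where A: "A \<in> F" using figure_nonempty assms by blast
  have "{A \<in> F. v \<in> A} \<subseteq> (\<lambda>a. (+) (v - a) ` A) ` A"
  proof
    fix B assume B: "B \<in> {A \<in> F. v \<in> A}"
    then obtain t where t: "B = (+) t ` A" using figure_rep(1)[OF assms A] by blast
    then obtain a where "a \<in> A" "v = t + a" using B by blast
    then have "B = (+) (v - a) ` A" using t by simp
    then show "B \<in> (\<lambda>a. (+) (v - a) ` A) ` A" using \<open>a \<in> A\<close> by blast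
  qed
  then show ?thesis using figure_rep(2)[OF assms A] finite_surj by blast
qed

lemma placements_subset: "X \<in> placements n F \<Longrightarrow> X \<subseteq> range (torus_proj n)"
  by (auto simp: placements_def)

lemma placements_nonempty: "F \<in> figures \<Longrightarrow> X \<in> placements n F \<Longrightarrow> X \<noteq> {}"
  using figure_rep(3) by (auto simp: placements_def)

lemma finite_placements: "n > 0 \<Longrightarrow> finite (placements n (F :: (int ^ 'd::finite) set set))"
  by (rule finite_subset[of _ "Pow (range (torus_proj n))"])
     (auto simp: finite_range_torus_proj dest: placements_subset)

lemma placements_translate:
  assumes "F \<in> figures" "X \<in> placements n F" shows "torus_translate n t X \<in> placements n F"
proof -
  obtain A where A: "X = torus_proj n ` A" "A \<in> F" "fits_torus n A"
    using assms(2) by (auto simp: placements_def)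
  then have "torus_translate n t X = torus_proj n ` ((+) t ` A)" by (simp add: torus_translate_proj)
  moreover have "(+) t ` A \<in> F" "fits_torus n ((+) t ` A)"
    using A figure_translate[OF assms(1)] by auto
  ultimately show ?thesis unfolding placements_def by blast
qed

lemma placements_eq:
  assumes "F \<in> figures" "A \<in> F" "fits_torus n A"
  shows "placements n F = (\<lambda>t. torus_proj n ` (+) t ` A) ` range (torus_proj n)"
proof
  show "placements n F \<subseteq> (\<lambda>t. torus_proj n ` (+) t ` A) ` range (torus_proj n)"
  proof
    fix X assume "X \<in> placements n F"
    then obtain t where t: "X = torus_proj n ` (+) t ` A"
      using figure_rep(1)[OF assms(1,2)] by (auto simp: placements_def)
    have "torus_proj n (t + a) = torus_proj n (torus_proj n t + a)" for a
      by (metis torus_proj_add add.commute)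
    then have "X = torus_proj n ` (+) (torus_proj n t) ` A" by (simp add: t image_image)
    then show "X \<in> (\<lambda>t. torus_proj n ` (+) t ` A) ` range (torus_proj n)" by blast
  qed
  have "torus_proj n ` (+) t ` A \<in> placements n F" for t
    using assms figure_translate[OF assms(1,2), of t] unfolding placements_def
    by (auto intro!: exI[of _ "(+) t ` A"])
  then show "(\<lambda>t. torus_proj n ` (+) t ` A) ` range (torus_proj n) \<subseteq> placements n F" by blast
qed

text \<open>In every coordinate, \<open>A\<close> projects into an arc of less than half the circle, and such an arc has a
  well-defined first point: two candidates would each lie less than half a turn after the other.
  Equal images therefore have first points that agree, and with them the translations.\<close>

lemma placement_determines_translation:
  assumes "roomy n A" "finite A" "A \<noteq> {}"
    and eq: "torus_proj n ` (+) s ` A = torus_proj n ` (+) t ` A"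
  shows "torus_proj n s = torus_proj n t"
proof -
  have "s $ i mod int n = t $ i mod int n" for i
  proof -
    obtain a where a: "a \<in> A" "\<And>b. b \<in> A \<Longrightarrow> a $ i \<le> b $ i"
      using ex_min_if_finite[of "(\<lambda>v. v $ i) ` A"] assms(2,3) by (fastforce simp: not_less)
    have "torus_proj n (s + a) \<in> torus_proj n ` (+) t ` A" using a(1) eq by blast
    then obtain b where b: "b \<in> A" "torus_proj n (s + a) = torus_proj n (t + b)" by blast
    have "torus_proj n (t + a) \<in> torus_proj n ` (+) s ` A" using a(1) eq by blast
    then obtain c where c: "c \<in> A" "torus_proj n (t + a) = torus_proj n (s + c)" by blast
    have "(s + a) $ i mod int n = (t + b) $ i mod int n" using b(2) by (metis torus_proj_nth)
    then have 1: "int n dvd (s $ i + a $ i) - (t $ i + b $ i)" by (simp add: mod_eq_dvd_iff)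
    have "(t + a) $ i mod int n = (s + c) $ i mod int n" using c(2) by (metis torus_proj_nth)
    then have 2: "int n dvd (t $ i + a $ i) - (s $ i + c $ i)" by (simp add: mod_eq_dvd_iff)
    \<comment> \<open>Adding the two congruences cancels both translations.\<close>
    have "int n dvd - (((s $ i + a $ i) - (t $ i + b $ i)) + ((t $ i + a $ i) - (s $ i + c $ i)))"
      using dvd_add[OF 1 2] by (simp only: dvd_minus_iff)
    then have 3: "int n dvd (b $ i - a $ i) + (c $ i - a $ i)" by (simp add: algebra_simps)
    have "2 * \<bar>b $ i - a $ i\<bar> < int n" "2 * \<bar>c $ i - a $ i\<bar> < int n"
      using assms(1) a(1) b(1) c(1) by (auto simp: roomy_def)
    with a(2)[OF b(1)] a(2)[OF c(1)] have
      4: "0 \<le> (b $ i - a $ i) + (c $ i - a $ i)" "(b $ i - a $ i) + (c $ i - a $ i) < int n"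
      by (simp_all add: abs_of_nonneg)
    have "(b $ i - a $ i) + (c $ i - a $ i) = 0"
      using 3 4 zdvd_imp_le[of "int n" "(b $ i - a $ i) + (c $ i - a $ i)"] by linarith
    then have "b $ i = a $ i" using a(2)[OF b(1)] a(2)[OF c(1)] by linarith
    then show ?thesis using 1 by (simp add: mod_eq_dvd_iff)
  qed
  then show ?thesis by (simp add: vec_eq_iff)
qed

lemma card_placements:
  fixes A :: "(int ^ 'd::finite) set"
  assumes "F \<in> figures" "A \<in> F" "roomy n A" "n > 0"
  shows "card (placements n F) = n ^ CARD('d)"
proof -
  have "inj_on (\<lambda>t. torus_proj n ` (+) t ` A) (range (torus_proj n))"
  proof (rule inj_onI)
    fix s t assume st: "s \<in> range (torus_proj n)" "t \<in> range (torus_proj n)"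
      "torus_proj n ` (+) s ` A = torus_proj n ` (+) t ` A"
    from placement_determines_translation[OF assms(3) figure_rep(2,3)[OF assms(1,2)] st(3)] st(1,2)
    show "s = t" by auto
  qed
  then show ?thesis
    by (simp add: placements_eq[OF assms(1,2) roomy_fits[OF assms(3)]] card_image
        finite_range_torus_proj assms(4))
qed

locale weighted_figures =
  fixes S :: "(int ^ 'd::finite) set set set" and w :: "(int ^ 'd) set set \<Rightarrow> nat"
  assumes figures: "S \<subseteq> figures"
    and w_pos: "F \<in> S \<Longrightarrow> w F > 0"
    and finite_w_eq: "finite {F \<in> S. w F = x}"
begin

definition placed :: "nat \<Rightarrow> ((int ^ 'd) set set \<times> (int ^ 'd) set) set" where
  "placed n = {(F, X). F \<in> S \<and> X \<in> placements n F}"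

abbreviation weight :: "(int ^ 'd) set set \<times> (int ^ 'd) set \<Rightarrow> nat" where
  "weight p \<equiv> w (fst p)"

abbreviation Zn :: "nat \<Rightarrow> (int ^ 'd) set \<Rightarrow> real fps" where
  "Zn n \<equiv> hard_core_gas.Z (placed n) weight snd"

abbreviation Rn :: "nat \<Rightarrow> (int ^ 'd) set \<Rightarrow> real fps" where
  "Rn n \<equiv> hard_core_gas.ratio (placed n) weight snd"

lemma finite_w_le: "finite {F \<in> S. w F \<le> k}"
proof -
  have "{F \<in> S. w F \<le> k} = (\<Union>i\<in>{..k}. {F \<in> S. w F = i})" by auto
  then show ?thesis using finite_w_eq by simp
qed

lemma figure: "F \<in> S \<Longrightarrow> F \<in> figures"
  using figures by blast

lemma hard_core_gas_placed:
  assumes "n > 0" shows "hard_core_gas (placed n) weight snd"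
proof
  show "finite {p \<in> placed n. weight p = k}" for k
  proof -
    have "{p \<in> placed n. weight p = k} = (SIGMA F:{F \<in> S. w F = k}. placements n F)"
      by (auto simp: placed_def)
    then show ?thesis by (simp add: finite_w_eq finite_placements assms)
  qed
  show "weight p > 0" if "p \<in> placed n" for p
    using that w_pos by (auto simp: placed_def)
  show "snd p \<noteq> {}" if "p \<in> placed n" for p
    using that placements_nonempty[OF figure, of "fst p" "snd p"] by (auto simp: placed_def)
qed

lemma Zn_nth:
  assumes "n > 0" shows "fps_nth (Zn n {}) k = real (num_packings S w k n)"
proof -
  interpret hard_core_gas "placed n" weight snd by (rule hard_core_gas_placed[OF assms])
  have "configs {} k = packings S w k n"
    unfolding configs_def packings_def by (auto simp: placed_def case_prod_beta)
  then show ?thesis by (simp add: Z_def num_packings_def)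
qed

text \<open>Translations permute the placements of each figure, hence the packings.\<close>

lemma Zn_translate:
  assumes "n > 0" "B \<subseteq> range (torus_proj n)"
  shows "Zn n (torus_translate n t B) = Zn n B"
proof -
  interpret hard_core_gas "placed n" weight snd by (rule hard_core_gas_placed[OF assms(1)])
  have le: "card (configs B k) \<le> card (configs (torus_translate n t B) k)"
    if "B \<subseteq> range (torus_proj n)" for B t k
  proof -
    have "inj_on (map_prod id (torus_translate n t)) (placed n)"
      by (rule inj_on_inverseI[where g = "map_prod id (torus_translate n (- t))"])
         (auto simp: placed_def torus_translate_inverse dest: placements_subset)
    then show ?thesis unfolding torus_translate_def[of n t B]
    proof (rule card_configs_image_le[OF _ _ _ _ _ that inj_on_torus_translate])
      show "map_prod id (torus_translate n t) ` placed n \<subseteq> placed n"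
        by (auto simp: placed_def placements_translate figure)
    qed (auto simp: torus_translate_def placed_def intro: placements_subset[THEN subsetD])
  qed
  have "card (configs (torus_translate n t B) k) \<le> card (configs B k)" for k
    using le[of "torus_translate n t B" k "- t"] torus_translate_inverse[OF assms(2)]
    by (force simp: torus_translate_def)
  then have "card (configs (torus_translate n t B) k) = card (configs B k)" for k
    using le[OF assms(2)] by (simp add: le_antisym)
  then show ?thesis by (simp add: Z_def)
qed

text \<open>Locality of the ratios, by induction on the degree \<open>j\<close> and then on the set \<open>B\<close>, along the recursion
  \<open>ratio_insert\<close>. The sum in that recursion involves the placed figures of weight at most \<open>j\<close>
  through \<open>v\<close>. In the infinite grid there are finitely many of them, and as soon as the union of
  all of these with \<open>B\<close> is roomy, projection identifies them with those on the torus and preserves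
  disjointness from \<open>B\<close>.\<close>

lemma ratio_eventually_constant:
  "finite B \<Longrightarrow> \<exists>c. eventually (\<lambda>n. fps_nth (Rn n (torus_proj n ` B)) j = c) sequentially"
proof (induction j arbitrary: B rule: less_induct)
  case (less j)
  from less.prems show ?case
  proof (induction B rule: finite_induct)
    case empty
    have "eventually (\<lambda>n. fps_nth (Rn n (torus_proj n ` {})) j = fps_nth 1 j) sequentially"
      using eventually_gt_at_top[of 0]
      by eventually_elim (simp add: hard_core_gas.ratio_empty[OF hard_core_gas_placed])
    then show ?case by blast
  next
    case (insert v B)
    define L where "L = (SIGMA F:{F \<in> S. w F \<le> j}. {A \<in> F. v \<in> A})"
    define L' where "L' = {(F, A) \<in> L. A \<inter> B = {}}"
    have finL: "finite L"
      unfolding L_def by (intro finite_SigmaI finite_w_le finite_figure_through) (auto simp: figure)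
    then have finL': "finite L'" by (rule rev_finite_subset) (auto simp: L'_def)
    define U where "U = insert v (B \<union> (\<Union>(F, A)\<in>L. A))"
    have finU: "finite U"
      using insert.hyps finL by (auto simp: U_def L_def dest: figure figure_rep(2))
    obtain cB where cB: "eventually (\<lambda>n. fps_nth (Rn n (torus_proj n ` B)) j = cB) sequentially"
      using insert.IH by blast
    have "\<exists>c. eventually (\<lambda>n. fps_nth (Rn n (torus_proj n ` (B \<union> snd p))) (j - weight p) = c) sequentially"
      if p: "p \<in> L'" for p
    proof (rule less.IH)
      have "fst p \<in> S" "w (fst p) \<le> j" "snd p \<in> fst p" using p by (auto simp: L'_def L_def)
      then show "j - weight p < j" "finite (B \<union> snd p)"
        using w_pos[of "fst p"] insert.hyps figure_rep(2)[OF figure] by auto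
    qed
    then have "\<exists>c. \<forall>p\<in>L'. eventually (\<lambda>n.
        fps_nth (Rn n (torus_proj n ` (B \<union> snd p))) (j - weight p) = c p) sequentially"
      by (intro bchoice ballI)
    then obtain c where c: "\<forall>p\<in>L'. eventually (\<lambda>n.
        fps_nth (Rn n (torus_proj n ` (B \<union> snd p))) (j - weight p) = c p) sequentially"
      by (rule exE)
    have "eventually (\<lambda>n. \<forall>p\<in>L'. fps_nth (Rn n (torus_proj n ` (B \<union> snd p))) (j - weight p) = c p) sequentially"
      by (rule eventually_ball_finite[OF finL' c])
    with cB eventually_gt_at_top[of 0] eventually_roomy[OF finU]
    have "eventually (\<lambda>n. fps_nth (Rn n (torus_proj n ` insert v B)) j = cB - (\<Sum>p\<in>L'. c p)) sequentially"
    proof eventually_elim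
      case (elim n)
      interpret hard_core_gas "placed n" weight snd
        by (rule hard_core_gas_placed) (use elim in simp)
      define h :: "(int ^ 'd) set set \<times> (int ^ 'd) set \<Rightarrow> _"
        where "h = map_prod id ((`) (torus_proj n))"
      have inj: "inj_on (torus_proj n) U" by (rule inj_on_torus_proj[OF elim(3)])
      have LU: "A \<subseteq> U" if "(F, A) \<in> L" for F A using that by (force simp: U_def)
      have BU: "B \<subseteq> U" by (auto simp: U_def)
      have disj: "torus_proj n ` A \<inter> torus_proj n ` B = {} \<longleftrightarrow> A \<inter> B = {}" if "(F, A) \<in> L" for F A
        using inj_on_image_Int[OF inj LU[OF that] BU] by (metis image_is_empty)
      have injh: "inj_on h L'"
      proof (rule inj_onI)
        fix p q assume pq: "p \<in> L'" "q \<in> L'" "h p = h q"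
        then have "snd p \<subseteq> U" "snd q \<subseteq> U"
          using LU[of "fst p" "snd p"] LU[of "fst q" "snd q"] by (auto simp: L'_def)
        with pq(3) show "p = q"
          using inj_on_image_eq_iff[OF inj] by (auto simp: h_def map_prod_def prod_eq_iff case_prod_beta)
      qed
      have "{p \<in> placed n. torus_proj n v \<in> snd p \<and> snd p \<inter> torus_proj n ` B = {} \<and> weight p \<le> j}
          = h ` L'" (is "?T = _")
      proof
        show "h ` L' \<subseteq> ?T"
        proof (rule image_subsetI)
          fix p assume p: "p \<in> L'"
          obtain F A where FA: "p = (F, A)" by (cases p)
          with p have L: "(F, A) \<in> L" "A \<inter> B = {}" by (simp_all add: L'_def)
          then have A: "F \<in> S" "w F \<le> j" "A \<in> F" "v \<in> A" by (simp_all add: L_def)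
          have "fits_torus n A" by (intro roomy_fits roomy_subset[OF elim(3)] LU[OF L(1)])
          then have "(F, torus_proj n ` A) \<in> placed n"
            using A by (auto simp: placed_def placements_def)
          with A L show "h p \<in> ?T" by (simp add: h_def FA disj)
        qed
        show "?T \<subseteq> h ` L'"
        proof
          fix p assume p: "p \<in> ?T"
          obtain F X where FX: "p = (F, X)" by (cases p)
          with p have X: "(F, X) \<in> placed n" "torus_proj n v \<in> X"
            "X \<inter> torus_proj n ` B = {}" "w F \<le> j" by simp_all
          then obtain A where A: "F \<in> S" "A \<in> F" "X = torus_proj n ` A"
            by (auto simp: placed_def placements_def)
          with X obtain a where a: "a \<in> A" "torus_proj n v = torus_proj n a" by auto
          \<comment> \<open>Only some lift of \<open>v\<close> lies in \<open>A\<close>; translate \<open>A\<close> by a multiple of \<open>n\<close> to pass through \<open>v\<close>.\<close>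
          define A' where "A' = (+) (v - a) ` A"
          have "torus_proj n (v - a + b) = torus_proj n b" for b
            using a(2) torus_proj_add[of n "b - a" v] torus_proj_add[of n "b - a" a]
            by (simp add: algebra_simps)
          then have XA': "X = torus_proj n ` A'" by (simp add: A'_def A(3) image_image)
          have "v \<in> A'" using a(1) by (force simp: A'_def)
          moreover have "A' \<in> F" unfolding A'_def using A figure figure_translate by blast
          ultimately have L: "(F, A') \<in> L" using A X by (auto simp: L_def)
          then have "(F, A') \<in> L'" using X(3) XA' disj[OF L] by (simp add: L'_def)
          then have "h (F, A') \<in> h ` L'" by (rule imageI)
          then show "p \<in> h ` L'" by (simp add: h_def FX XA')
        qed
      qed
      then have "fps_nth (ratio (torus_proj n ` insert v B)) j = fps_nth (ratio (torus_proj n ` B)) j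
          - (\<Sum>p\<in>h ` L'. fps_nth (ratio (torus_proj n ` B \<union> snd p)) (j - weight p))"
        using ratio_insert[of "torus_proj n v" "torus_proj n ` B" j] by simp
      also have "(\<Sum>p\<in>h ` L'. fps_nth (ratio (torus_proj n ` B \<union> snd p)) (j - weight p))
          = (\<Sum>p\<in>L'. fps_nth (ratio (torus_proj n ` (B \<union> snd p))) (j - weight p))"
        unfolding sum.reindex[OF injh] by (rule sum.cong) (auto simp: h_def image_Un)
      also have "\<dots> = (\<Sum>p\<in>L'. c p)" using elim(4) by simp
      finally show ?case using elim(1) by simp
    qed
    then show ?case by blast
  qed
qed

definition rep :: "(int ^ 'd) set set \<Rightarrow> (int ^ 'd) set" where
  "rep F = (SOME A. A \<in> F)"

text \<open>The coefficients of \<open>D\<^sub>n\<close>, where \<open>x Z\<^sub>n' / Z\<^sub>n = N D\<^sub>n\<close> in every degree in which the figures involved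
  are roomy.\<close>

definition log_deriv_coeff :: "nat \<Rightarrow> nat \<Rightarrow> real" where
  "log_deriv_coeff n i =
     (\<Sum>F | F \<in> S \<and> w F \<le> i. real (w F) * fps_nth (Rn n (torus_proj n ` rep F)) (i - w F))"

lemma rep: assumes "F \<in> S" shows "rep F \<in> F" "finite (rep F)"
proof -
  show "rep F \<in> F" unfolding rep_def using figure_nonempty[OF figure[OF assms]] by (rule someI_ex)
  then show "finite (rep F)" using figure_rep(2)[OF figure[OF assms]] by blast
qed

lemma log_deriv_coeff_0: "log_deriv_coeff n 0 = 0"
proof -
  have "{F. F \<in> S \<and> w F \<le> 0} = {}" using w_pos by force
  then show ?thesis unfolding log_deriv_coeff_def by (simp only: sum.empty)
qed

lemma log_deriv_coeff_eventually_constant: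
  "\<exists>c. eventually (\<lambda>n. log_deriv_coeff n i = c) sequentially"
proof -
  have "\<exists>c. eventually (\<lambda>n. fps_nth (Rn n (torus_proj n ` rep F)) (i - w F) = c) sequentially"
    if "F \<in> S" for F
    by (rule ratio_eventually_constant[OF rep(2)[OF that]])
  then have "\<exists>c. \<forall>F\<in>S. eventually (\<lambda>n. fps_nth (Rn n (torus_proj n ` rep F)) (i - w F) = c F) sequentially"
    by (intro bchoice ballI)
  then obtain c where c: "\<forall>F\<in>S.
      eventually (\<lambda>n. fps_nth (Rn n (torus_proj n ` rep F)) (i - w F) = c F) sequentially"
    by (rule exE)
  have "eventually (\<lambda>n. \<forall>F\<in>{F \<in> S. w F \<le> i}.
      fps_nth (Rn n (torus_proj n ` rep F)) (i - w F) = c F) sequentially"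
    using finite_w_le c by (intro eventually_ball_finite) auto
  then have "eventually (\<lambda>n. log_deriv_coeff n i = (\<Sum>F | F \<in> S \<and> w F \<le> i. real (w F) * c F)) sequentially"
    by eventually_elim (simp add: log_deriv_coeff_def)
  then show ?thesis by blast
qed

lemma Zn_placement:
  assumes "n > 0" "F \<in> figures" "A \<in> F" "fits_torus n A" "X \<in> placements n F"
  shows "Zn n X = Zn n (torus_proj n ` A)"
proof -
  obtain t where "X = torus_proj n ` (+) t ` A"
    using assms(5) unfolding placements_eq[OF assms(2-4)] by blast
  then have "X = torus_translate n t (torus_proj n ` A)" by (simp add: torus_translate_proj)
  then show ?thesis using Zn_translate[OF assms(1), of "torus_proj n ` A" t] by auto
qed

text \<open>In \<open>weighted_Z_nth\<close>, the placements of one figure contribute equally by translation invariance, and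
  there are \<open>n\<^sup>d\<close> of them. Writing each contribution as a ratio times \<open>Z\<^sub>n\<close> gives the convolution.\<close>

lemma eventually_num_packings_recurrence:
  "eventually (\<lambda>n. real k * real (num_packings S w k n) =
     real (n ^ CARD('d)) * (\<Sum>i\<le>k. log_deriv_coeff n i * real (num_packings S w (k - i) n))) sequentially"
proof -
  have "eventually (\<lambda>n. \<forall>F\<in>{F \<in> S. w F \<le> k}. roomy n (rep F)) sequentially"
    using finite_w_le rep(2) by (intro eventually_ball_finite) (auto intro: eventually_roomy)
  with eventually_gt_at_top[of 0] show ?thesis
  proof eventually_elim
    case (elim n)
    interpret hard_core_gas "placed n" weight snd
      by (rule hard_core_gas_placed) (use elim in simp)
    let ?S = "{F \<in> S. w F \<le> k}" and ?R = "\<lambda>F. ratio (torus_proj n ` rep F)"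
    define G where "G = (\<Sum>F\<in>?S. fps_const (real (w F)) * (fps_X ^ w F * ?R F))"
    have G: "fps_nth G i = log_deriv_coeff n i" if "i \<le> k" for i
    proof -
      have "fps_nth G i = (\<Sum>F\<in>?S. if w F \<le> i then real (w F) * fps_nth (?R F) (i - w F) else 0)"
        unfolding G_def by (auto simp: fps_sum_nth fps_X_power_mult_nth intro!: sum.cong)
      also have "\<dots> = (\<Sum>F\<in>?S \<inter> {F. w F \<le> i}. real (w F) * fps_nth (?R F) (i - w F))"
        by (simp add: sum.If_cases finite_w_le)
      also have "?S \<inter> {F. w F \<le> i} = {F. F \<in> S \<and> w F \<le> i}" using that by auto
      finally show ?thesis by (simp add: log_deriv_coeff_def)
    qed
    have "real k * fps_nth (Z {}) k
        = (\<Sum>p | p \<in> placed n \<and> weight p \<le> k. real (weight p) * fps_nth (Z (snd p)) (k - weight p))"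
      by (rule weighted_Z_nth)
    also have "{p. p \<in> placed n \<and> weight p \<le> k} = (SIGMA F:?S. placements n F)"
      by (auto simp: placed_def)
    also have "(\<Sum>p\<in>(SIGMA F:?S. placements n F). real (weight p) * fps_nth (Z (snd p)) (k - weight p))
        = (\<Sum>F\<in>?S. \<Sum>X\<in>placements n F. real (w F) * fps_nth (Z X) (k - w F))"
      by (subst sum.Sigma) (auto simp: finite_w_le finite_placements elim(1) case_prod_beta)
    also have "\<dots> = (\<Sum>F\<in>?S. real (n ^ CARD('d)) * fps_nth (fps_const (real (w F)) * (fps_X ^ w F * ?R F) * Z {}) k)"
    proof (rule sum.cong[OF refl])
      fix F assume F: "F \<in> ?S"
      then have fig: "F \<in> figures" and rp: "rep F \<in> F" and room: "roomy n (rep F)"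
        using elim(2) figure rep(1) by auto
      have "(\<Sum>X\<in>placements n F. real (w F) * fps_nth (Z X) (k - w F))
          = (\<Sum>X\<in>placements n F. real (w F) * fps_nth (?R F * Z {}) (k - w F))"
        by (rule sum.cong) (simp_all only: ratio_times_Z Zn_placement[OF elim(1) fig rp roomy_fits[OF room]])
      also have "\<dots> = real (n ^ CARD('d)) * (real (w F) * fps_nth (?R F * Z {}) (k - w F))"
        using card_placements[OF fig rp room elim(1)] by simp
      also have "real (w F) * fps_nth (?R F * Z {}) (k - w F)
          = fps_nth (fps_const (real (w F)) * (fps_X ^ w F * ?R F) * Z {}) k"
        using F by (simp add: mult.assoc fps_X_power_mult_nth)
      finally show "(\<Sum>X\<in>placements n F. real (w F) * fps_nth (Z X) (k - w F))
          = real (n ^ CARD('d)) * fps_nth (fps_const (real (w F)) * (fps_X ^ w F * ?R F) * Z {}) k" .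
    qed
    also have "\<dots> = real (n ^ CARD('d)) * fps_nth (G * Z {}) k"
      by (simp only: G_def sum_distrib_right fps_sum_nth flip: sum_distrib_left)
    also have "fps_nth (G * Z {}) k = (\<Sum>i\<le>k. log_deriv_coeff n i * fps_nth (Z {}) (k - i))"
      unfolding fps_mult_nth atLeast0AtMost by (rule sum.cong) (auto simp: G)
    finally show ?case by (simp only: Zn_nth[OF elim(1)])
  qed
qed

lemma num_packings_polynomial:
  "\<exists>d. \<forall>k. eventually (\<lambda>n. real (num_packings S w k n) =
     poly (log_deriv_poly d k) (real (n ^ CARD('d)))) sequentially"
proof -
  obtain d where d: "\<And>i. eventually (\<lambda>n. log_deriv_coeff n i = d i) sequentially"
    using log_deriv_coeff_eventually_constant by metis
  have "eventually (\<lambda>n. real (num_packings S w k n) =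
      poly (log_deriv_poly d k) (real (n ^ CARD('d)))) sequentially" for k
  proof -
    have "eventually (\<lambda>n. \<forall>i\<in>{..k}. log_deriv_coeff n i = d i) sequentially"
      using d by (intro eventually_ball_finite) auto
    moreover have "eventually (\<lambda>n. \<forall>j\<in>{..k}. real j * real (num_packings S w j n) =
        real (n ^ CARD('d)) * (\<Sum>i\<le>j. log_deriv_coeff n i * real (num_packings S w (j - i) n))) sequentially"
      using eventually_num_packings_recurrence by (intro eventually_ball_finite) auto
    ultimately show ?thesis using eventually_gt_at_top[of 0]
    proof eventually_elim
      case (elim n)
      show ?case
      proof (rule log_deriv_poly_unique)
        show "real (num_packings S w 0 n) = 1"
          using hard_core_gas.Z_nth_0[OF hard_core_gas_placed[OF elim(3)], of "{}"]
          by (simp only: Zn_nth[OF elim(3)])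
        fix j assume j: "j < k"
        have "real (Suc j) * real (num_packings S w (Suc j) n) = real (n ^ CARD('d)) *
            (\<Sum>i\<le>Suc j. log_deriv_coeff n i * real (num_packings S w (Suc j - i) n))"
          using elim(2) j by (simp del: of_nat_Suc sum.atMost_Suc)
        also have "(\<Sum>i\<le>Suc j. log_deriv_coeff n i * real (num_packings S w (Suc j - i) n))
            = (\<Sum>i\<le>j. log_deriv_coeff n (Suc i) * real (num_packings S w (j - i) n))"
          by (simp only: sum.atMost_Suc_shift log_deriv_coeff_0 diff_Suc_Suc mult_zero_left add_0)
        also have "\<dots> = (\<Sum>i\<le>j. d (Suc i) * real (num_packings S w (j - i) n))"
          using elim(1) j by (intro sum.cong) auto
        finally show "real (Suc j) * real (num_packings S w (Suc j) n)
            = real (n ^ CARD('d)) * (\<Sum>i\<le>j. d (Suc i) * real (num_packings S w (j - i) n))" .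
      qed
    qed
  qed
  then show ?thesis by blast
qed

end

theorem theorem5p1:
  fixes S :: "(int ^ 'd::finite) set set set"
    and w :: "(int ^ 'd) set set \<Rightarrow> nat"
  assumes "S \<subseteq> figures"
    and "\<And>F. F \<in> S \<Longrightarrow> connected_figure F"
    and "\<And>F. F \<in> S \<Longrightarrow> w F > 0"
    and "\<And>x. finite {F \<in> S. w F = x}"
  shows "\<exists>P :: nat \<Rightarrow> real poly.
    (\<forall>k. \<exists>N::nat. \<forall>n\<ge>1. n \<ge> N \<longrightarrow>
       real (num_packings S w k n) = poly (P k) (real (n ^ CARD('d)))) \<and>
    binomial_type P"
proof -
  interpret weighted_figures S w
    using assms(1,3,4) by unfold_locales
  obtain d where d: "\<And>k. eventually (\<lambda>n. real (num_packings S w k n) =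
      poly (log_deriv_poly d k) (real (n ^ CARD('d)))) sequentially"
    using num_packings_polynomial by blast
  have "\<forall>k. \<exists>N::nat. \<forall>n\<ge>1. n \<ge> N \<longrightarrow>
      real (num_packings S w k n) = poly (log_deriv_poly d k) (real (n ^ CARD('d)))"
    using d unfolding eventually_sequentially by blast
  then show ?thesis using binomial_type_log_deriv_poly by blast
qed

end
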